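(* Let $f,g\in S(\mathbb{R})$. Then: (i) $\int_{\mathbb{R}}\overline{\eta_A(\omega)}\,\mathcal{F}_A(\overline{\rho_A}f)(\omega)\,g(\omega)\,d\omega=\int_{\mathbb{R}}\overline{\eta_A(\omega)}\,f(\omega)\,\mathcal{F}_A(\overline{\rho_A}g)(\omega)\,d\omega.$ (ii) $\int_{\mathbb{R}}\overline{\eta_A(\omega)}\,\mathcal{F}_Af(\omega)\,\rho_A(\omega)g(\omega)\,d\omega=\int_{\mathbb{R}}\overline{\eta_A(\omega)}\,\rho_A(\omega)f(\omega)\,\mathcal{F}_Ag(\omega)\,d\omega.$ (iii) If $a=d$ and $p=q=0$, then $\int_{\mathbb{R}}\mathcal{F}_A(f)(\omega)g(\omega)\,d\omega=\int_{\mathbb{R}}f(\omega)\mathcal{F}_A(g)(\omega)\,d\omega.$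
   Context: $A=\{a,b,c,d,p,q\}$ are real parameters with $ad-bc=1$ and $b\neq0$. $S(\mathbb{R})$ is the Schwartz space. The special affine Fourier transform is $\mathcal{F}_Af(\omega)=\frac{1}{\sqrt{|b|}}\int_{\mathbb{R}}f(t)e^{\frac{\pi i}{b}(at^2+2pt-2\omega t+2(bq-dp)\omega+d\omega^2)}\,dt$. The auxiliary functions are $\rho_A(t)=e^{\frac{\pi i}{b}(at^2+2pt)}$ and $\eta_A(\omega)=e^{\frac{\pi i}{b}(d\omega^2+2(bq-dp)\omega)}$. *)

theory Defs
  imports "HOL-Analysis.Analysis"
begin

definition nth_vderiv :: "nat \<Rightarrow> (real \<Rightarrow> complex) \<Rightarrow> real \<Rightarrow> complex" where
  "nth_vderiv n = (\<lambda>f t. vector_derivative f (at t)) ^^ n"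

(* vector_derivative is total (unspecified where no derivative exists), so the first
   conjunct is what makes f infinitely differentiable and the derivatives meaningful. *)
definition schwartz :: "(real \<Rightarrow> complex) set" where
  "schwartz = {f. (\<forall>n t. nth_vderiv n f differentiable (at t)) \<and>
     (\<forall>m n. bounded (range (\<lambda>t. complex_of_real (t ^ m) * nth_vderiv n f t)))}"

text \<open>The parameter collection A = (a, b, c, d, p, q). The entry c enters only through
  the constraint a d - b c = 1.\<close>
type_synonym saft_param = "real \<times> real \<times> real \<times> real \<times> real \<times> real"

fun saft_rho :: "saft_param \<Rightarrow> real \<Rightarrow> complex" where
  "saft_rho (a, b, c, d, p, q) t =
     exp (\<i> * complex_of_real (pi / b * (a * t\<^sup>2 + 2 * p * t)))"

fun saft_eta :: "saft_param \<Rightarrow> real \<Rightarrow> complex" where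
  "saft_eta (a, b, c, d, p, q) \<omega> =
     exp (\<i> * complex_of_real (pi / b * (d * \<omega>\<^sup>2 + 2 * (b * q - d * p) * \<omega>)))"

fun saft :: "saft_param \<Rightarrow> (real \<Rightarrow> complex) \<Rightarrow> real \<Rightarrow> complex" where
  "saft (a, b, c, d, p, q) f \<omega> =
     complex_of_real (1 / sqrt \<bar>b\<bar>) *
     (LINT t|lborel. f t * exp (\<i> * complex_of_real
        (pi / b * (a * t\<^sup>2 + 2 * p * t - 2 * \<omega> * t + 2 * (b * q - d * p) * \<omega> + d * \<omega>\<^sup>2))))"

end

theory Submission
  imports Defs "HOL-Probability.Sinc_Integral"
begin

text \<open>
  Splitting the exponential gives \<open>saft A f = \<eta>\<^sub>A \<cdot> T (\<rho>\<^sub>A f)\<close>, where \<open>T\<close> is a rescaled Fourier transform,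
  i.e. integration against a bounded symmetric kernel. By Fubini such an operator is symmetric
  for the bilinear pairing of integrable functions. Since \<open>\<rho>\<^sub>A\<close> and \<open>\<eta>\<^sub>A\<close> are unimodular (and
  coincide if \<open>a = d\<close>, \<open>p = q = 0\<close>), each of the three identities is this symmetry for a suitable pair of
  integrable functions.
\<close>

lemma integrable_inverse_one_plus_square: "integrable lborel (\<lambda>t::real. inverse (1 + t\<^sup>2))"
  using integrable_inverse_1_plus_square by (simp add: set_integrable_def)

text \<open>Only decay of order two is used: adding the Schwartz bounds for \<open>m = 0\<close> and
  \<open>m = 2\<close> on the undifferentiated function gives the integrable majorant
  \<open>(C + D) / (1 + t\<^sup>2)\<close>, and continuity supplies measurability.\<close>

lemma schwartz_integrable:
  assumes "f \<in> schwartz"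
  shows "integrable lborel f"
proof -
  have "nth_vderiv 0 f differentiable (at t)" for t
    using assms unfolding schwartz_def by blast
  then have cont: "continuous_on UNIV f"
    by (simp add: nth_vderiv_def continuous_at_imp_continuous_on differentiable_imp_continuous_within)
  have bdd: "bounded (range (\<lambda>t. complex_of_real (t ^ m) * nth_vderiv 0 f t))" for m
    using assms unfolding schwartz_def by blast
  obtain C where C: "\<And>t. norm (f t) \<le> C"
    using bdd[of 0] by (auto simp: bounded_iff nth_vderiv_def)
  obtain D where D: "\<And>t. norm (complex_of_real (t\<^sup>2) * f t) \<le> D"
    using bdd[of 2] by (auto simp: bounded_iff nth_vderiv_def)
  have bound: "norm (f t) \<le> (C + D) * inverse (1 + t\<^sup>2)" for t
  proof -
    have "norm (f t) * (1 + t\<^sup>2) \<le> C + D"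
      using C[of t] D[of t] by (simp add: norm_mult norm_power algebra_simps)
    moreover have "1 + t\<^sup>2 > 0"
      by (simp add: add_pos_nonneg)
    ultimately show ?thesis
      by (simp add: field_simps)
  qed
  show ?thesis
  proof (rule Bochner_Integration.integrable_bound)
    show "integrable lborel (\<lambda>t. (C + D) * inverse (1 + t\<^sup>2))"
      by (intro integrable_mult_right integrable_inverse_one_plus_square)
    show "f \<in> borel_measurable lborel"
      using cont by (simp add: borel_measurable_continuous_onI)
    show "AE t in lborel. norm (f t) \<le> norm ((C + D) * inverse (1 + t\<^sup>2))"
      using bound by (intro AE_I2) (metis abs_ge_self order_trans real_norm_def)
  qed
qed

lemma integrable_unimodular_mult:
  fixes f :: "'a \<Rightarrow> complex"
  assumes "integrable M f" and [measurable]: "u \<in> borel_measurable M"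
    and u: "\<And>t. norm (u t) = 1"
  shows "integrable M (\<lambda>t. u t * f t)"
proof (rule Bochner_Integration.integrable_bound[OF assms(1)])
  have [measurable]: "f \<in> borel_measurable M"
    using assms(1) by auto
  show "(\<lambda>t. u t * f t) \<in> borel_measurable M"
    by measurable
qed (simp add: norm_mult u)

text \<open>Both sides are iterated integrals of \<open>f x * K x y * g y\<close>. Boundedness of
  \<open>K\<close> makes this integrable on the product, so Fubini exchanges the order, and symmetry
  of \<open>K\<close> then lets \<open>g\<close> take the place of \<open>f\<close> as the
  transformed function.\<close>

lemma symmetric_kernel_pairing:
  fixes f g :: "'a \<Rightarrow> complex" and K :: "'a \<Rightarrow> 'a \<Rightarrow> complex"
  assumes M: "sigma_finite_measure M"
    and f: "integrable M f" and g: "integrable M g"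
    and K [measurable]: "case_prod K \<in> borel_measurable (M \<Otimes>\<^sub>M M)"
    and bound: "\<And>x y. norm (K x y) \<le> C"
    and sym: "\<And>x y. K x y = K y x"
  shows "(LINT y|M. (LINT x|M. f x * K x y) * g y) = (LINT y|M. f y * (LINT x|M. g x * K x y))"
proof -
  interpret sigma_finite_measure M by (rule M)
  interpret pair_sigma_finite M M ..
  have [measurable]: "f \<in> borel_measurable M" "g \<in> borel_measurable M"
    using f g by auto
  have fg: "integrable (M \<Otimes>\<^sub>M M) (\<lambda>(x, y). f x * g y)"
  proof (rule Fubini_integrable)
    show "integrable M (\<lambda>x. LINT y|M. norm (case (x, y) of (x, y) \<Rightarrow> f x * g y))"
      using f by (simp add: norm_mult)
  qed (use g in auto)
  have int: "integrable (M \<Otimes>\<^sub>M M) (\<lambda>(x, y). f x * K x y * g y)"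
  proof (rule Bochner_Integration.integrable_bound)
    show "integrable (M \<Otimes>\<^sub>M M) (\<lambda>z. C * norm (case z of (x, y) \<Rightarrow> f x * g y))"
      by (intro integrable_mult_right integrable_norm fg)
    show "AE z in M \<Otimes>\<^sub>M M. norm (case z of (x, y) \<Rightarrow> f x * K x y * g y)
        \<le> norm (C * norm (case z of (x, y) \<Rightarrow> f x * g y))"
    proof (intro AE_I2, clarify)
      fix x y
      \<comment> \<open>The sign of \<open>C\<close> is not given directly, so the majorant is
        compared through \<bar>C\<bar>.\<close>
      have "norm (K x y) * norm (f x * g y) \<le> \<bar>C\<bar> * norm (f x * g y)"
        using bound[of x y] by (intro mult_right_mono) auto
      then show "norm (f x * K x y * g y) \<le> norm (C * norm (f x * g y))"
        by (simp add: norm_mult abs_mult mult_ac)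
    qed
  qed measurable
  have "(LINT y|M. (LINT x|M. f x * K x y) * g y) = (LINT y|M. (LINT x|M. f x * K x y * g y))"
    by simp
  also have "\<dots> = (LINT x|M. (LINT y|M. f x * K x y * g y))"
    by (rule Fubini_integral[OF int])
  also have "\<dots> = (LINT x|M. f x * (LINT y|M. g y * K y x))"
  proof -
    \<comment> \<open>Pulling out the constant \<open>f x\<close> is unconditional, since
      non-integrable functions have Bochner integral 0.\<close>
    have "(LINT y|M. f x * K x y * g y) = f x * (LINT y|M. g y * K y x)" for x
      unfolding integral_mult_right_zero[symmetric] by (simp add: sym[of x] mult_ac)
    then show ?thesis by simp
  qed
  finally show ?thesis .
qed

text \<open>This is the Fourier transform at frequency \<open>\<omega> / b\<close>, scaled by
  \<open>1 / sqrt \<bar>b\<bar>\<close>. The scale sits inside the integral so that the whole factor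
  next to \<open>f t\<close> is a symmetric kernel of constant modulus.\<close>

definition scaled_fourier :: "real \<Rightarrow> (real \<Rightarrow> complex) \<Rightarrow> real \<Rightarrow> complex" where
  "scaled_fourier b f \<omega> =
     (LINT t|lborel. f t * (complex_of_real (1 / sqrt \<bar>b\<bar>) * cis (- 2 * pi / b * (\<omega> * t))))"

lemma scaled_fourier_pairing:
  assumes "integrable lborel f" and "integrable lborel g"
  shows "(LINT \<omega>|lborel. scaled_fourier b f \<omega> * g \<omega>) = (LINT \<omega>|lborel. f \<omega> * scaled_fourier b g \<omega>)"
  unfolding scaled_fourier_def
proof (rule symmetric_kernel_pairing[where C = "1 / sqrt \<bar>b\<bar>"])
  \<comment> \<open>Naming the coefficients keeps the continuity proof from descending into
    divisions by terms in \<open>b\<close>.\<close>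
  define k where "k = - 2 * pi / b"
  define s where "s = complex_of_real (1 / sqrt \<bar>b\<bar>)"
  show "(\<lambda>(t, \<omega>). complex_of_real (1 / sqrt \<bar>b\<bar>) * cis (- 2 * pi / b * (\<omega> * t)))
      \<in> borel_measurable (lborel \<Otimes>\<^sub>M lborel)"
    unfolding lborel_prod case_prod_beta measurable_lborel2 k_def[symmetric] s_def[symmetric]
    by (intro borel_measurable_continuous_onI continuous_intros)
qed (use assms in \<open>simp_all add: sigma_finite_lborel norm_mult norm_divide mult.commute\<close>)

lemma saft_rho_cis: "saft_rho (a, b, c, d, p, q) t = cis (pi / b * (a * t\<^sup>2 + 2 * p * t))"
  by (simp add: cis_conv_exp)

lemma saft_eta_cis:
  "saft_eta (a, b, c, d, p, q) \<omega> = cis (pi / b * (d * \<omega>\<^sup>2 + 2 * (b * q - d * p) * \<omega>))"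
  by (simp add: cis_conv_exp)

lemma norm_saft_rho: "norm (saft_rho A t) = 1"
  by (cases A) (simp only: saft_rho_cis norm_cis)

lemma norm_saft_eta: "norm (saft_eta A t) = 1"
  by (cases A) (simp only: saft_eta_cis norm_cis)

lemma cnj_saft_rho_mult: "cnj (saft_rho A t) * saft_rho A t = 1"
  by (metis complex_norm_square mult.commute norm_saft_rho of_real_1 power_one)

lemma cnj_saft_eta_mult: "cnj (saft_eta A t) * saft_eta A t = 1"
  by (metis complex_norm_square mult.commute norm_saft_eta of_real_1 power_one)

lemma saft_rho_measurable: "saft_rho A \<in> borel_measurable borel"
proof (cases A)
  case (fields a b c d p q)
  define k where "k = pi / b"
  have "saft_rho A = (\<lambda>t. cis (k * (a * t\<^sup>2 + 2 * p * t)))"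
    unfolding fields saft_rho_cis k_def ..
  then show ?thesis
    by (simp only:) (intro borel_measurable_continuous_onI continuous_intros)
qed

lemma saft_eq_scaled_fourier:
  "saft (a, b, c, d, p, q) f \<omega> =
     saft_eta (a, b, c, d, p, q) \<omega> * scaled_fourier b (\<lambda>t. saft_rho (a, b, c, d, p, q) t * f t) \<omega>"
proof -
  have "exp (\<i> * complex_of_real
        (pi / b * (a * t\<^sup>2 + 2 * p * t - 2 * \<omega> * t + 2 * (b * q - d * p) * \<omega> + d * \<omega>\<^sup>2))) =
      saft_eta (a, b, c, d, p, q) \<omega> * (saft_rho (a, b, c, d, p, q) t * cis (- 2 * pi / b * (\<omega> * t)))" for t
    \<comment> \<open>Products of \<open>cis\<close> add phases, so only an identity between real
      phases remains; the cross term \<open>- 2 * \<omega> * t\<close> is the Fourier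
      kernel.\<close>
    unfolding saft_eta_cis saft_rho_cis cis_mult cis_conv_exp[symmetric]
    by (rule arg_cong[where f = cis]) (simp add: algebra_simps add_divide_distrib diff_divide_distrib)
  then show ?thesis
    unfolding saft.simps scaled_fourier_def
    by (simp only: integral_mult_right_zero[symmetric] mult_ac)
qed

theorem theorem3p2:
  fixes a b c d p q :: real and A :: saft_param and f g :: "real \<Rightarrow> complex"
  assumes A: "A = (a, b, c, d, p, q)"
    and det: "a * d - b * c = 1"
    and b: "b \<noteq> 0"
    and f: "f \<in> schwartz"
    and g: "g \<in> schwartz"
  shows
    "((LINT \<omega>|lborel. cnj (saft_eta A \<omega>) * saft A (\<lambda>t. cnj (saft_rho A t) * f t) \<omega> * g \<omega>) =
     (LINT \<omega>|lborel. cnj (saft_eta A \<omega>) * f \<omega> * saft A (\<lambda>t. cnj (saft_rho A t) * g t) \<omega>)) \<and>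
     ((LINT \<omega>|lborel. cnj (saft_eta A \<omega>) * saft A f \<omega> * (saft_rho A \<omega> * g \<omega>)) =
     (LINT \<omega>|lborel. cnj (saft_eta A \<omega>) * (saft_rho A \<omega> * f \<omega>) * saft A g \<omega>)) \<and>
     (a = d \<and> p = 0 \<and> q = 0 \<longrightarrow>
     (LINT \<omega>|lborel. saft A f \<omega> * g \<omega>) = (LINT \<omega>|lborel. f \<omega> * saft A g \<omega>))"
proof -
  have intf: "integrable lborel f" and intg: "integrable lborel g"
    using f g by (auto intro: schwartz_integrable)
  have int_rho: "integrable lborel (\<lambda>t. saft_rho A t * h t)" if "integrable lborel h" for h
    using that by (rule integrable_unimodular_mult) (auto simp: saft_rho_measurable norm_saft_rho)
  have saft: "saft A h \<omega> = saft_eta A \<omega> * scaled_fourier b (\<lambda>t. saft_rho A t * h t) \<omega>" for h \<omega>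
    unfolding A by (rule saft_eq_scaled_fourier)
  have cnj_eta_saft: "cnj (saft_eta A \<omega>) * saft A h \<omega> = scaled_fourier b (\<lambda>t. saft_rho A t * h t) \<omega>"
    for h \<omega>
    unfolding saft by (metis cnj_saft_eta_mult mult.assoc mult_1)
  have cnj_rho: "saft_rho A t * (cnj (saft_rho A t) * z) = z" for t z
    by (metis cnj_saft_rho_mult mult.assoc mult.commute mult_1)
  have right: "cnj (saft_eta A \<omega>) * z * saft A h \<omega> = z * scaled_fourier b (\<lambda>t. saft_rho A t * h t) \<omega>"
    for h \<omega> z
    by (metis cnj_eta_saft mult.assoc mult.commute)
  \<comment> \<open>This instance, with both functions multiplied by \<open>saft_rho A\<close>,
    serves the second and third identities.\<close>
  note pairing = scaled_fourier_pairing[OF int_rho[OF intf] int_rho[OF intg], of b]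
  have "(LINT \<omega>|lborel. saft A f \<omega> * g \<omega>) = (LINT \<omega>|lborel. f \<omega> * saft A g \<omega>)"
    if "a = d" "p = 0" "q = 0"
  proof -
    \<comment> \<open>The outer factor \<open>saft_eta A\<close> of one transform can now be read as
      the \<open>saft_rho A\<close> that the pairing wants on the other function.\<close>
    have "saft_eta A \<omega> = saft_rho A \<omega>" for \<omega>
      using that by (simp add: A)
    then show ?thesis
      using pairing unfolding saft by (simp add: mult_ac)
  qed
  moreover have "(LINT \<omega>|lborel. cnj (saft_eta A \<omega>) * saft A f \<omega> * (saft_rho A \<omega> * g \<omega>)) =
     (LINT \<omega>|lborel. cnj (saft_eta A \<omega>) * (saft_rho A \<omega> * f \<omega>) * saft A g \<omega>)"
    unfolding cnj_eta_saft right by (rule pairing)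
  moreover have
    "(LINT \<omega>|lborel. cnj (saft_eta A \<omega>) * saft A (\<lambda>t. cnj (saft_rho A t) * f t) \<omega> * g \<omega>) =
     (LINT \<omega>|lborel. cnj (saft_eta A \<omega>) * f \<omega> * saft A (\<lambda>t. cnj (saft_rho A t) * g t) \<omega>)"
    \<comment> \<open>The conjugate chirp on the input cancels the one inside \<open>saft\<close>,
      so the pairing applies to \<open>f\<close> and \<open>g\<close> themselves.\<close>
    unfolding cnj_eta_saft right cnj_rho by (rule scaled_fourier_pairing[OF intf intg])
  ultimately show ?thesis
    by blast
qed

end
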